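(* Let $p/q$ be a rational number in lowest terms, let $m\ge 0$ be an integer, and let $(u_n)_{n\ge1}$ be an arbitrary sequence of positive integers. Write $p/q=[a_0;a_1,\dots,a_{2k}]$ as a finite continued fraction whose last partial quotient has even index $2k$, and let $q_{2k-1}$ be the denominator of its $(2k-1)$th convergent. Suppose $x_1=q>1$, and let $\alpha$ be given by the series $$\alpha=\frac pq+\sum_{j=2}^\infty\frac{(-1)^j}{x_j},$$ where $(x_n)_{n\ge1}$, together with $(y_n)_{n\ge0}$, is defined by $$y_j=y_{j-1}(1+u_jx_j),\qquad x_{j+1}=x_jy_j,\qquad j\ge 1,$$ with $$x_1=q,\qquad y_0=mq+q_{2k-1}-1,$$ and where the restriction $m\ge1$ is imposed if $q_{2k-1}=1$. Then the continued fraction expansion of $\alpha$ has the form $\alpha=[a_0;a_1,a_2,\dots]$, where the partial quotients $a_j$ coincide with those of $p/q=[a_0;a_1,\dots,a_{2k}]$ for $0\le j\le 2k$, while $$a_{2k+1}=m+u_1y_0-1,$$ and $$a_{2k+3j-1}=1,\qquad a_{2k+3j}=x_j-1,\qquad a_{2k+3j+1}=u_{j+1}y_j-1\qquad\text{for all } j\ge 1.$$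
   Context: Continued fractions: $[a_0;a_1,\dots,a_n]=a_0+\cfrac{1}{a_1+\cfrac{1}{\cdots+\cfrac1{a_n}}}=p_n/q_n$ with $a_0\in\mathbb Z$, $a_j\in\mathbb Z_{>0}$ for $j\ge1$, and $p_n/q_n$ in lowest terms with $q_n>0$; an infinite continued fraction is $[a_0;a_1,a_2,\dots]=\lim_{n\to\infty}[a_0;a_1,\dots,a_n]$. The numerators and denominators of the convergents $p_n/q_n$ satisfy $p_{n+1}=a_{n+1}p_n+p_{n-1}$, $q_{n+1}=a_{n+1}q_n+q_{n-1}$ for $n\ge -1$, with $p_{-1}=1$, $p_{-2}=0$, $q_{-1}=0$, $q_{-2}=1$. Every rational number has a finite continued fraction whose last index is even, because $[a_0;\dots,a_j]=[a_0;\dots,a_j-1,1]$ if $j=0$ or $a_j>1$, and $[a_0;\dots,a_{j-1},1]=[a_0;\dots,a_{j-1}+1]$.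
   Formalization: If m=0, u_1=1 and q_{2k-1}=2 (e.g. p/q=1/3=[0;2,1]), the formula gives a_{2k+1}=0, so the expansion is not regular; there only the limit equality with this zero quotient is asserted. In all other cases all a_j with j≥1 are shown positive. *)

theory Defs
  imports Complex_Main
begin

text \<open>
  \<open>cfrac a n\<close> is the finite continued fraction \<open>[a 0; a 1, \<dots>, a n]\<close>. Positivity of the
  partial quotients \<open>a 1, a 2, \<dots>\<close> is not built in and has to be stated separately.
\<close>

primrec cfrac :: "(nat \<Rightarrow> int) \<Rightarrow> nat \<Rightarrow> rat" where
  "cfrac a 0 = of_int (a 0)"
| "cfrac a (Suc n) = of_int (a 0) + 1 / cfrac (\<lambda>i. a (Suc i)) n"

text \<open>\<open>quotient_of\<close> yields the representation in lowest terms with positive denominator.\<close>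

definition cfrac_denom :: "(nat \<Rightarrow> int) \<Rightarrow> nat \<Rightarrow> int" where
  "cfrac_denom a n = snd (quotient_of (cfrac a n))"

text \<open>
  \<open>\<alpha> = [a 0; a 1, a 2, \<dots>]\<close>. A single partial quotient equal to \<open>0\<close> at a position \<open>i \<ge> 1\<close>
  among otherwise positive ones is meaningful here: a division by zero can occur
  only in the finite continued fraction ending exactly at \<open>i\<close>, which does not affect the limit.
\<close>

definition has_cfrac_value :: "(nat \<Rightarrow> int) \<Rightarrow> real \<Rightarrow> bool" where
  "has_cfrac_value a \<alpha> \<longleftrightarrow> (\<lambda>n. of_rat (cfrac a n)) \<longlonglongrightarrow> \<alpha>"

end

theory Submission
  imports Defs
begin

text \<open>
  The denominators of the convergents with indices \<open>2k + 3j - 3\<close>, \<open>2k + 3j - 2\<close>, \<open>2k + 3j - 1\<close>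
  are \<open>x j\<close>, \<open>y j + 1 - x j\<close>, \<open>y j + 1\<close>. Convergents three indices apart therefore differ,
  by the determinant identity, by exactly one term of the series, so the convergents with index
  \<open>2k + 3j\<close> are the partial sums defining \<open>\<alpha>\<close>. Since consecutive convergents become arbitrarily
  close, all convergents tend to \<open>\<alpha>\<close>.
\<close>

section \<open>Numerators and denominators of convergents, and the determinant identities\<close>

fun conv_num :: "(nat \<Rightarrow> int) \<Rightarrow> nat \<Rightarrow> int" where
  "conv_num a 0 = a 0"
| "conv_num a (Suc 0) = a 1 * a 0 + 1"
| "conv_num a (Suc (Suc n)) = a (Suc (Suc n)) * conv_num a (Suc n) + conv_num a n"

fun conv_den :: "(nat \<Rightarrow> int) \<Rightarrow> nat \<Rightarrow> int" where
  "conv_den a 0 = 1"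
| "conv_den a (Suc 0) = a 1"
| "conv_den a (Suc (Suc n)) = a (Suc (Suc n)) * conv_den a (Suc n) + conv_den a n"

text \<open>\<open>cfrac\<close> peels off the first partial quotient, whereas the recurrences
  append at the end. This shift and the next one reconcile the two directions in
  \<open>cfrac_eq_conv\<close>.\<close>

lemma conv_den_Suc_shift: "conv_den a (Suc n) = conv_num (\<lambda>i. a (Suc i)) n"
  by (induction "\<lambda>i. a (Suc i)" n rule: conv_num.induct) auto

lemma conv_num_Suc_shift:
  "conv_num a (Suc n) = a 0 * conv_num (\<lambda>i. a (Suc i)) n + conv_den (\<lambda>i. a (Suc i)) n"
  by (induction "\<lambda>i. a (Suc i)" n rule: conv_num.induct) (auto simp: algebra_simps)

lemma conv_den_cong: "(\<And>j. j \<le> n \<Longrightarrow> a j = b j) \<Longrightarrow> conv_den a n = conv_den b n"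
  by (induction b n rule: conv_den.induct) auto

lemma cfrac_cong: "(\<And>j. j \<le> n \<Longrightarrow> a j = b j) \<Longrightarrow> cfrac a n = cfrac b n"
proof (induction n arbitrary: a b)
  case (Suc n)
  have "cfrac (\<lambda>i. a (Suc i)) n = cfrac (\<lambda>i. b (Suc i)) n"
    using Suc.prems by (intro Suc.IH) auto
  then show ?case using Suc.prems[of 0] by simp
qed simp

lemma conv_det:
  "conv_num a (Suc n) * conv_den a n - conv_num a n * conv_den a (Suc n) = (-1) ^ n"
proof (induction n)
  case (Suc n)
  have "conv_num a (Suc (Suc n)) * conv_den a (Suc n) - conv_num a (Suc n) * conv_den a (Suc (Suc n))
     = - (conv_num a (Suc n) * conv_den a n - conv_num a n * conv_den a (Suc n))"
    by (simp add: algebra_simps)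
  then show ?case by (simp only: Suc.IH) simp
qed simp

text \<open>Numerator and denominator at \<open>n + 3\<close> are the same combination of their
  values at \<open>n + 1\<close> and \<open>n\<close>. The multiples of the values at
  \<open>n\<close> cancel, and the coefficient at \<open>n + 1\<close> multiplies the
  determinant.\<close>

lemma conv_det3:
  "conv_num a (n + 3) * conv_den a n - conv_num a n * conv_den a (n + 3)
     = (-1) ^ n * (a (n + 2) * a (n + 3) + 1)"
proof -
  have "conv_num a (n + 3) * conv_den a n - conv_num a n * conv_den a (n + 3) =
     (a (n + 2) * a (n + 3) + 1) *
       (conv_num a (Suc n) * conv_den a n - conv_num a n * conv_den a (Suc n))"
    by (simp add: eval_nat_numeral algebra_simps)
  then show ?thesis unfolding conv_det by (simp only: mult.commute)
qed

lemma coprime_conv: "coprime (conv_num a n) (conv_den a n)"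
proof (rule coprimeI)
  fix d assume "d dvd conv_num a n" "d dvd conv_den a n"
  then have "d dvd conv_num a (Suc n) * conv_den a n - conv_num a n * conv_den a (Suc n)"
    by simp
  then have "d dvd (-1) ^ n" by (simp only: conv_det)
  then show "is_unit d" by (rule dvd_trans) (simp add: is_unit_power_iff)
qed

section \<open>Finite continued fractions as quotients of the recurrences\<close>

lemma cfrac_pos:
  assumes "\<And>j. j < n \<Longrightarrow> a j \<ge> 0" and "a n > 0"
  shows "cfrac a n > 0"
  using assms
proof (induction n arbitrary: a)
  case (Suc n)
  have "cfrac (\<lambda>i. a (Suc i)) n > 0"
    using Suc.prems by (intro Suc.IH) auto
  then show ?case using Suc.prems(1)[of 0] by (simp add: add_nonneg_pos)
qed simp

text \<open>
  Only the last partial quotient has to be nonzero: a zero in an earlier position is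
  followed by a positive tail, hence causes no division by zero.
\<close>

lemma cfrac_eq_conv:
  assumes "\<And>j. 1 \<le> j \<Longrightarrow> j < n \<Longrightarrow> a j \<ge> 0" and "n \<ge> 1 \<Longrightarrow> a n > 0"
  shows "conv_den a n > 0 \<and> cfrac a n = of_int (conv_num a n) / of_int (conv_den a n)"
  using assms
proof (induction n arbitrary: a)
  case (Suc n)
  let ?s = "\<lambda>i. a (Suc i)"
  have pos: "cfrac ?s n > 0"
    using Suc.prems by (intro cfrac_pos) auto
  have IH: "conv_den ?s n > 0 \<and> cfrac ?s n = of_int (conv_num ?s n) / of_int (conv_den ?s n)"
    using Suc.prems by (intro Suc.IH) auto
  have num: "conv_num ?s n > 0"
    using pos IH by (simp add: zero_less_divide_iff)
  have "cfrac a (Suc n) = of_int (a 0) + of_int (conv_den ?s n) / of_int (conv_num ?s n)"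
    using IH by simp
  also have "\<dots> = of_int (conv_num a (Suc n)) / of_int (conv_den a (Suc n))"
    using num by (simp add: conv_num_Suc_shift conv_den_Suc_shift field_simps)
  finally show ?case using num by (simp add: conv_den_Suc_shift)
qed simp

lemma snd_quotient_of_divide:
  assumes "coprime p q" and "q > 0"
  shows "snd (quotient_of (of_int p / of_int q)) = q"
  using assms by (simp add: Fract_of_int_quotient [symmetric] quotient_of_Fract normalize_def)

lemma cfrac_denom_eq_conv_den:
  assumes "\<And>j. 1 \<le> j \<Longrightarrow> j \<le> n \<Longrightarrow> a j > 0"
  shows "cfrac_denom a n = conv_den a n"
proof -
  have "conv_den a n > 0 \<and> cfrac a n = of_int (conv_num a n) / of_int (conv_den a n)"
    using assms by (intro cfrac_eq_conv) (auto intro: less_imp_le)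
  then show ?thesis
    by (simp add: cfrac_denom_def snd_quotient_of_divide coprime_conv)
qed

section \<open>Growth of denominators and convergence along all indices\<close>

lemma conv_den_ge_linear:
  assumes "\<And>n. conv_den a n > 0" and "\<And>j. j > M \<Longrightarrow> a j > 0"
  shows "conv_den a (M + i) \<ge> int i"
proof (induction i)
  case (Suc i)
  show ?case
  proof (cases "M + i")
    case 0
    then show ?thesis using assms(2)[of 1] by simp
  next
    case (Suc n)
    have "1 * conv_den a (Suc n) \<le> a (Suc (Suc n)) * conv_den a (Suc n)"
      using assms(1)[of "Suc n"] assms(2)[of "Suc (Suc n)"] Suc
      by (intro mult_right_mono) auto
    then show ?thesis using Suc.IH assms(1)[of n] Suc by simp
  qed
qed (use assms(1)[of M] in simp)

text \<open>By the determinant identity the difference is, up to sign, the reciprocal of the product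
  of two consecutive denominators. Positivity of \<open>a j\<close> is asked only beyond
  \<open>M\<close>, which leaves room for a zero partial quotient earlier on.\<close>

lemma conv_diff_tendsto_zero:
  assumes pos: "\<And>n. conv_den a n > 0" and "\<And>j. j > M \<Longrightarrow> a j > 0"
  defines "c \<equiv> \<lambda>n. real_of_int (conv_num a n) / real_of_int (conv_den a n)"
  shows "(\<lambda>n. c (Suc n) - c n) \<longlonglongrightarrow> 0"
proof (rule LIMSEQ_offset[where k = M], rule tendsto_rabs_zero_cancel,
    rule tendsto_sandwich[OF _ _ tendsto_const LIMSEQ_inverse_real_of_nat])
  show "\<forall>\<^sub>F i in sequentially. \<bar>c (Suc (i + M)) - c (i + M)\<bar> \<le> inverse (real (Suc i))"
  proof (rule always_eventually, rule allI)
    fix i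
    let ?n = "M + i"
    have p: "real_of_int (conv_den a ?n) \<ge> 1" "real_of_int (conv_den a (Suc ?n)) \<ge> 1"
      using pos[of ?n] pos[of "Suc ?n"] by linarith+
    have ge: "real_of_int (conv_den a (Suc ?n)) \<ge> real (Suc i)"
      using conv_den_ge_linear[OF assms(1,2), of M "Suc i"] by simp
    have "c (Suc ?n) - c ?n
        = real_of_int (conv_num a (Suc ?n) * conv_den a ?n - conv_num a ?n * conv_den a (Suc ?n))
            / (real_of_int (conv_den a ?n) * real_of_int (conv_den a (Suc ?n)))"
      using p by (simp add: c_def field_simps)
    also have "\<dots> = (-1) ^ ?n / (real_of_int (conv_den a ?n) * real_of_int (conv_den a (Suc ?n)))"
      by (simp only: conv_det) simp
    finally have "\<bar>c (Suc ?n) - c ?n\<bar>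
        = 1 / (real_of_int (conv_den a ?n) * real_of_int (conv_den a (Suc ?n)))"
      using p by (simp add: abs_mult power_abs)
    also have "\<dots> \<le> 1 / (1 * real (Suc i))"
      using p ge by (intro divide_left_mono mult_mono mult_pos_pos) auto
    finally show "\<bar>c (Suc (i + M)) - c (i + M)\<bar> \<le> inverse (real (Suc i))"
      by (simp add: add.commute inverse_eq_divide)
  qed
qed simp

text \<open>Adding the vanishing difference carries the limit from one residue class mod 3 to the
  next; two such shifts reach every class.\<close>

lemma LIMSEQ_from_step3:
  fixes f :: "nat \<Rightarrow> real"
  assumes sub: "(\<lambda>j. f (M + 3 * j)) \<longlonglongrightarrow> L" and diff: "(\<lambda>n. f (Suc n) - f n) \<longlonglongrightarrow> 0"
  shows "f \<longlonglongrightarrow> L"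
proof (rule LIMSEQ_I)
  have step: "(\<lambda>j. f (Suc r + 3 * j)) \<longlonglongrightarrow> L" if "(\<lambda>j. f (r + 3 * j)) \<longlonglongrightarrow> L" for r
  proof -
    have "strict_mono (\<lambda>j. r + 3 * j)" by (simp add: strict_mono_def)
    from tendsto_add[OF that LIMSEQ_subseq_LIMSEQ[OF diff this]]
    show ?thesis by (simp add: o_def)
  qed
  fix e :: real assume "e > 0"
  obtain N0 where N0: "\<And>j. j \<ge> N0 \<Longrightarrow> norm (f (M + 3 * j) - L) < e"
    using LIMSEQ_D[OF sub \<open>e > 0\<close>] by blast
  obtain N1 where N1: "\<And>j. j \<ge> N1 \<Longrightarrow> norm (f (Suc M + 3 * j) - L) < e"
    using LIMSEQ_D[OF step[OF sub] \<open>e > 0\<close>] by blast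
  obtain N2 where N2: "\<And>j. j \<ge> N2 \<Longrightarrow> norm (f (Suc (Suc M) + 3 * j) - L) < e"
    using LIMSEQ_D[OF step[OF step[OF sub]] \<open>e > 0\<close>] by blast
  have "norm (f n - L) < e" if "n \<ge> M + 3 * (N0 + N1 + N2)" for n
  proof -
    define j where "j = (n - M) div 3"
    have "j \<ge> N0 + N1 + N2" using that by (simp add: j_def)
    moreover have "n = M + 3 * j \<or> n = Suc M + 3 * j \<or> n = Suc (Suc M) + 3 * j"
      using that unfolding j_def by presburger
    ultimately show ?thesis using N0[of j] N1[of j] N2[of j] by auto
  qed
  then show "\<exists>N. \<forall>n\<ge>N. norm (f n - L) < e" by blast
qed

text \<open>The zero alternative in the sign clause really occurs: if \<open>m = 0\<close>,
  \<open>u 1 = 1\<close> and the denominator at \<open>2 * k - 1\<close> is 2, then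
  \<open>y 0 = 1\<close> and the formula for \<open>b (2 * k + 1)\<close> gives 0.\<close>

theorem theorem2p2:
  fixes p q m :: int and u x y a :: "nat \<Rightarrow> int" and k :: nat and \<alpha> :: real
  assumes "coprime p q" and "q > 1"
    and "m \<ge> 0"
    and "\<forall>n\<ge>1. u n > 0"
    and "\<forall>j. 1 \<le> j \<and> j \<le> 2 * k \<longrightarrow> a j > 0"
    and "cfrac a (2 * k) = of_int p / of_int q"
    and "cfrac_denom a (2 * k - 1) = 1 \<longrightarrow> m \<ge> 1"
    and "x 1 = q"
    and "y 0 = m * q + cfrac_denom a (2 * k - 1) - 1"
    and "\<forall>j\<ge>1. y j = y (j - 1) * (1 + u j * x j)"
    and "\<forall>j\<ge>1. x (j + 1) = x j * y j"
    and "\<alpha> = of_int p / of_int q + (\<Sum>i. (-1) ^ (i + 2) / of_int (x (i + 2)))"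
  shows "summable (\<lambda>i. (-1) ^ (i + 2) / of_int (x (i + 2)) :: real) \<and>
    (\<exists>b :: nat \<Rightarrow> int.
      (\<forall>j\<le>2 * k. b j = a j) \<and>
      b (2 * k + 1) = m + u 1 * y 0 - 1 \<and>
      (\<forall>j\<ge>1. b (2 * k + 3 * j - 1) = 1 \<and>
              b (2 * k + 3 * j) = x j - 1 \<and>
              b (2 * k + 3 * j + 1) = u (j + 1) * y j - 1) \<and>
      (\<forall>j\<ge>1. b j > 0 \<or>
        (j = 2 * k + 1 \<and> b j = 0 \<and> m = 0 \<and> u 1 = 1 \<and> cfrac_denom a (2 * k - 1) = 2)) \<and>
      has_cfrac_value b \<alpha>)"
proof -
  note cop = assms(1) and q = assms(2) and m = assms(3) and u = assms(4) and a = assms(5)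
    and val = assms(6) and x1 = assms(8) and y0 = assms(9) and alpha = assms(12)
  have yrec: "y (Suc j) = y j * (1 + u (Suc j) * x (Suc j))" for j
    using assms(10)[rule_format, of "Suc j"] by simp
  have xrec: "x (Suc (Suc j)) = x (Suc j) * y (Suc j)" for j
    using assms(11)[rule_format, of "Suc j"] by simp
  have upos: "u (Suc j) \<ge> 1" for j using u[rule_format, of "Suc j"] by simp
  have den2k: "conv_den a (2 * k) = q"
    using cfrac_denom_eq_conv_den[of "2 * k" a] a q cop val
    by (simp add: cfrac_denom_def snd_quotient_of_divide)
  \<comment> \<open>Thus \<open>2 * k - 1\<close> is a true predecessor, not a truncated
    subtraction.\<close>
  have "k \<noteq> 0" using den2k q by (intro notI) simp
  then obtain l where l: "2 * k = Suc (Suc (2 * l))" by (cases k) auto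
  define r where "r = cfrac_denom a (2 * k - 1)"
  have r: "r = conv_den a (2 * k - 1)"
    unfolding r_def using a by (intro cfrac_denom_eq_conv_den) auto
  have "conv_den a (2 * k - 1) > 0"
    using a l by (intro cfrac_eq_conv[THEN conjunct1]) (auto intro: less_imp_le)
  then have rpos: "r \<ge> 1" by (simp add: r)
  have y0': "y 0 = m * q + r - 1" using y0 by (simp add: r_def)
  \<comment> \<open>The restriction on \<open>m\<close> enters here: \<open>r = 1\<close> with
    \<open>m = 0\<close> would give \<open>y 0 = 0\<close> and make every \<open>y j\<close>
    vanish.\<close>
  have y0pos: "y 0 \<ge> 1"
  proof (cases "r = 1")
    case True
    then have "m \<ge> 1" using assms(7) by (simp add: r_def)
    then have "m * q \<ge> 1 * 1" using q by (intro mult_mono) auto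
    then show ?thesis using True y0' by simp
  next
    case False
    then show ?thesis using rpos m q y0' mult_nonneg_nonneg[of m q] by linarith
  qed
  \<comment> \<open>The bounds feed each other: \<open>y (Suc j) \<ge> 2\<close> doubles
    \<open>x\<close>, and the size of \<open>x\<close> keeps the factor multiplying \<open>y\<close>
    above 1. The powers of 2 serve for summability.\<close>
  have xy: "x (Suc j) \<ge> 2 ^ Suc j \<and> y j \<ge> 1 \<and> y (Suc j) \<ge> 2" for j
  proof (induction j)
    case 0
    have "u 1 * x 1 \<ge> 1 * 2" using q x1 upos[of 0] by (intro mult_mono) auto
    then have "y 0 * (1 + u 1 * x 1) \<ge> 1 * 2" using y0pos by (intro mult_mono) auto
    then show ?case using q x1 y0pos yrec[of 0] by simp
  next
    case (Suc j)
    have "x (Suc j) \<ge> 0" using Suc order_trans[of 0 "2 ^ Suc j" "x (Suc j)"] by simp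
    then have "2 ^ Suc j * 2 \<le> x (Suc j) * y (Suc j)" using Suc by (intro mult_mono) auto
    then have X: "x (Suc (Suc j)) \<ge> 2 ^ Suc (Suc j)" using xrec[of j] by simp
    have "(1::int) \<le> 2 ^ Suc (Suc j)" by (rule one_le_power) simp
    then have "u (Suc (Suc j)) * x (Suc (Suc j)) \<ge> 1 * 1"
      using X upos[of "Suc j"] by (intro mult_mono) auto
    then have "y (Suc j) * (1 + u (Suc (Suc j)) * x (Suc (Suc j))) \<ge> 2 * 1"
      using Suc by (intro mult_mono) auto
    then show ?case using X Suc yrec[of "Suc j"] by simp
  qed
  have x2: "x (Suc j) \<ge> 2" for j
  proof -
    have "(1::int) \<le> 2 ^ j" by (rule one_le_power) simp
    then show ?thesis using xy[of j, THEN conjunct1] unfolding power_Suc by linarith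
  qed

  have summ: "summable (\<lambda>i. (-1) ^ (i + 2) / of_int (x (i + 2)) :: real)"
  proof (rule summable_comparison_test'[where N = 0])
    show "summable (\<lambda>i. (1 / 2 :: real) ^ i)" by (rule summable_geometric) simp
    fix i :: nat
    have "(2::int) ^ i \<le> 2 ^ Suc (Suc i)" by (rule power_increasing) auto
    then have "(2::int) ^ i \<le> x (i + 2)" using xy[of "Suc i"] unfolding add_2_eq_Suc' by linarith
    then have ge: "(2::real) ^ i \<le> of_int (x (i + 2))"
      by (metis of_int_le_iff of_int_numeral of_int_power)
    then have pos: "(0::real) < of_int (x (i + 2))" by (rule less_le_trans[rotated]) simp
    then have "norm ((-1) ^ (i + 2) / of_int (x (i + 2)) :: real) = 1 / of_int (x (i + 2))"
      by (simp add: norm_divide norm_power)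
    also have "\<dots> \<le> 1 / 2 ^ i" using ge pos by (intro divide_left_mono mult_pos_pos) auto
    finally show "norm ((-1) ^ (i + 2) / of_int (x (i + 2)) :: real) \<le> (1 / 2) ^ i"
      by (simp add: power_one_over)
  qed

  \<comment> \<open>The partial quotients of the expansion and their signs\<close>
  define b where "b n = (if n \<le> 2 * k then a n else if n = 2 * k + 1 then m + u 1 * y 0 - 1
      else (let i = n - (2 * k + 2); j = i div 3 + 1 in
        if i mod 3 = 0 then 1 else if i mod 3 = 1 then x j - 1 else u (j + 1) * y j - 1))" for n
  have b0: "b j = a j" if "j \<le> 2 * k" for j using that by (simp add: b_def)
  have b1: "b (2 * k + 1) = m + u 1 * y 0 - 1" by (simp add: b_def)
  \<comment> \<open>Blocks of three are counted from 0 here, so that no index involves a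
    subtraction; \<open>late\<close> translates back to blocks counted from 1.\<close>
  have b2: "b (2 * k + 3 * j + 2) = 1"
    and b3: "b (2 * k + 3 * j + 3) = x (Suc j) - 1"
    and b4: "b (2 * k + 3 * j + 4) = u (Suc (Suc j)) * y (Suc j) - 1" for j
  proof -
    have "2 * k + 3 * j + 3 - (2 * k + 2) = 3 * j + 1"
      and "2 * k + 3 * j + 4 - (2 * k + 2) = 3 * j + 2" by simp_all
    moreover have "(3 * j + 1) div 3 = j" "(3 * j + 1) mod 3 = 1"
      and "(3 * j + 2) div 3 = j" "(3 * j + 2) mod 3 = 2" by presburger+
    ultimately show "b (2 * k + 3 * j + 2) = 1" "b (2 * k + 3 * j + 3) = x (Suc j) - 1"
      "b (2 * k + 3 * j + 4) = u (Suc (Suc j)) * y (Suc j) - 1"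
      by (simp_all add: b_def Let_def)
  qed
  have uy0: "u 1 * y 0 \<ge> y 0" using upos[of 0] y0pos mult_right_mono[of 1 "u 1" "y 0"] by simp
  have b1nn: "b (2 * k + 1) \<ge> 0" using uy0 y0pos m b1 by linarith
  have b1zero: "m = 0 \<and> u 1 = 1 \<and> r = 2" if "b (2 * k + 1) = 0"
  proof -
    have m0: "m = 0" and uy: "u 1 * y 0 = 1" using that uy0 y0pos m b1 by linarith+
    then have "y 0 = 1" using uy0 y0pos by linarith
    then show ?thesis using m0 uy y0' by simp
  qed
  have bpos_late: "b n > 0" if n: "n > 2 * k + 1" for n
  proof -
    define j where "j = (n - (2 * k + 2)) div 3"
    have uyj: "u (Suc (Suc j)) * y (Suc j) \<ge> 1 * 2"
      using upos[of "Suc j"] xy[of j] by (intro mult_mono) auto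
    have "n = 2 * k + 3 * j + 2 \<or> n = 2 * k + 3 * j + 3 \<or> n = 2 * k + 3 * j + 4"
      using n unfolding j_def by presburger
    then show ?thesis using b2[of j] b3[of j] b4[of j] x2[of j] uyj by auto
  qed
  have bpos: "b n > 0" if "n \<ge> 1" "n \<noteq> 2 * k + 1" for n
    using that bpos_late[of n] a b0[of n] by (cases "n \<le> 2 * k") auto
  have bnn: "b n \<ge> 0" if "n \<ge> 1" for n
    using that bpos[of n] b1nn by (cases "n = 2 * k + 1") (auto intro: less_imp_le)
  \<comment> \<open>Index \<open>2 * k + 1\<close> is left out because \<open>cfrac_eq_conv\<close>
    needs a positive last quotient, and this one may be 0.\<close>
  have conv: "conv_den b n > 0 \<and> cfrac b n = of_int (conv_num b n) / of_int (conv_den b n)"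
    if "n \<noteq> 2 * k + 1" for n
    using that bnn bpos by (intro cfrac_eq_conv) auto

  \<comment> \<open>Denominators of the convergents of the expansion\<close>
  have d0: "conv_den b (2 * k) = x 1"
    using conv_den_cong[of "2 * k" b a] b0 den2k x1 by simp
  have dm1: "conv_den b (2 * k - 1) = r"
    unfolding r using b0 by (intro conv_den_cong) auto
  have step: "conv_den b (n + 2) = b (n + 2) * conv_den b (n + 1) + conv_den b n" for n
    by simp
  \<comment> \<open>The choice of \<open>y 0\<close> is made for this identity:
    \<open>m * q + r = y 0 + 1\<close> turns the recurrence into
    \<open>y 0 * (1 + u 1 * q) + 1 - q\<close>.\<close>
  have d1: "conv_den b (2 * k + 1) = y 1 + 1 - x 1"
  proof -
    have "conv_den b (2 * k + 1) = b (2 * k + 1) * conv_den b (2 * k) + conv_den b (2 * k - 1)"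
      using step[of "2 * k - 1"] l by simp
    also have "\<dots> = (m + u 1 * y 0 - 1) * q + r" by (simp only: b1 d0 dm1 x1)
    also have "\<dots> = y 0 * (1 + u 1 * q) + 1 - q" by (simp add: y0' algebra_simps)
    also have "\<dots> = y 1 + 1 - x 1" using yrec[of 0] x1 by simp
    finally show ?thesis .
  qed
  \<comment> \<open>Writing \<open>X\<close>, \<open>Y\<close> for \<open>x (Suc j)\<close>,
    \<open>y (Suc j)\<close>, the quotient 1 gives \<open>(Y + 1 - X) + X = Y + 1\<close>, and then
    \<open>X - 1\<close> gives \<open>(X - 1) * (Y + 1) + (Y + 1 - X) = X * Y\<close>, the next
    \<open>x\<close>. The third quotient restores the second half of the invariant.\<close>
  have den: "conv_den b (2 * k + 3 * j) = x (Suc j) \<and>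
      conv_den b (2 * k + 3 * j + 1) = y (Suc j) + 1 - x (Suc j)" for j
  proof (induction j)
    case 0
    then show ?case using d0 d1 by simp
  next
    case (Suc j)
    let ?n = "2 * k + 3 * j"
    have e2: "conv_den b (?n + 2) = y (Suc j) + 1"
      using step[of ?n] b2[of j] Suc by simp
    have "conv_den b (?n + 3) = b (?n + 3) * conv_den b (?n + 2) + conv_den b (?n + 1)"
      using step[of "?n + 1"] by (simp add: eval_nat_numeral)
    then have e3: "conv_den b (?n + 3) = x (Suc (Suc j))"
      using Suc by (simp only: b3 e2 xrec) (simp add: algebra_simps)
    have "conv_den b (?n + 4) = b (?n + 4) * conv_den b (?n + 3) + conv_den b (?n + 2)"
      using step[of "?n + 2"] by (simp add: eval_nat_numeral)
    then have e4: "conv_den b (?n + 4) = y (Suc (Suc j)) + 1 - x (Suc (Suc j))"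
      by (simp only: b4 e2 e3 yrec[of "Suc j"]) (simp add: algebra_simps)
    have "2 * k + 3 * Suc j = ?n + 3" "2 * k + 3 * Suc j + 1 = ?n + 4" by simp_all
    then show ?case using e3 e4 by (simp only:)
  qed
  \<comment> \<open>Even a zero quotient at \<open>2 * k + 1\<close> leaves the denominator
    \<open>r \<ge> 1\<close>.\<close>
  have dpos: "conv_den b n > 0" for n
  proof (cases "n = 2 * k + 1")
    case True
    have "conv_den b n = b (2 * k + 1) * x 1 + r"
      using True step[of "2 * k - 1"] l d0 dm1 by simp
    moreover have "b (2 * k + 1) * x 1 \<ge> 0" using b1nn x1 q by (intro mult_nonneg_nonneg) auto
    ultimately show ?thesis using rpos by linarith
  qed (use conv in blast)

  \<comment> \<open>Partial sums of the series and passage to the limit\<close>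
  define c where "c n = real_of_int (conv_num b n) / real_of_int (conv_den b n)" for n
  have cfrac_c: "of_rat (cfrac b n) = c n" if "n \<noteq> 2 * k + 1" for n
    using conv[OF that] by (simp add: c_def of_rat_divide)
  have partial: "c (2 * k + 3 * j)
      = of_int p / of_int q + (\<Sum>i<j. (-1) ^ (i + 2) / of_int (x (i + 2)))" for j
  proof (induction j)
    case 0
    have "cfrac b (2 * k) = of_int p / of_int q"
      using cfrac_cong[of "2 * k" b a] b0 val by simp
    then show ?case using cfrac_c[of "2 * k"] by (simp add: of_rat_divide)
  next
    case (Suc j)
    let ?n = "2 * k + 3 * j"
    have D: "conv_den b ?n = x (Suc j)" "conv_den b (?n + 3) = x (Suc (Suc j))"
      using den[of j] den[of "Suc j"] by (simp_all add: algebra_simps)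
    have X: "real_of_int (x (Suc j)) > 0" "real_of_int (x (Suc (Suc j))) > 0"
      using x2[of j] x2[of "Suc j"] by linarith+
    \<comment> \<open>The quotients 1 and \<open>x (Suc j) - 1\<close> make the factor in
      \<open>conv_det3\<close> equal to \<open>x (Suc j)\<close>, which cancels one of the two
      denominators.\<close>
    have "conv_num b (?n + 3) * x (Suc j) - conv_num b ?n * x (Suc (Suc j)) = (-1) ^ ?n * x (Suc j)"
      using conv_det3[of b ?n] b2[of j] b3[of j] D by simp
    \<comment> \<open>The evenness of the last index \<open>2 * k\<close> fixes the signs of the
      series here.\<close>
    also have "(-1) ^ ?n = ((-1) ^ j :: int)"
      by (simp add: power_add power_mult)
    finally have "real_of_int (conv_num b (?n + 3) * x (Suc j) - conv_num b ?n * x (Suc (Suc j)))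
        = real_of_int ((-1) ^ j * x (Suc j))" by (simp only:)
    then have "c (?n + 3) - c ?n = (-1) ^ j / of_int (x (Suc (Suc j)))"
      unfolding c_def D using X by (simp add: field_simps)
    moreover have "2 * k + 3 * Suc j = ?n + 3" by simp
    ultimately show ?case using Suc by (simp only: sum.lessThan_Suc) simp
  qed
  have "(\<lambda>j. c (2 * k + 3 * j)) \<longlonglongrightarrow> \<alpha>"
    unfolding partial alpha by (intro tendsto_add tendsto_const summable_LIMSEQ summ)
  moreover have "(\<lambda>n. c (Suc n) - c n) \<longlonglongrightarrow> 0"
    unfolding c_def by (rule conv_diff_tendsto_zero[OF dpos bpos_late])
  ultimately have "c \<longlonglongrightarrow> \<alpha>" by (rule LIMSEQ_from_step3)
  \<comment> \<open>\<open>cfrac b n\<close> and \<open>c n\<close> can differ only at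
    \<open>2 * k + 1\<close>, which the limit ignores.\<close>
  moreover have "\<forall>\<^sub>F n in sequentially. of_rat (cfrac b n) = c n"
    using eventually_gt_at_top[of "2 * k + 1"] by eventually_elim (simp add: cfrac_c)
  ultimately have cval: "has_cfrac_value b \<alpha>"
    unfolding has_cfrac_value_def by (simp add: tendsto_cong)

  have late: "b (2 * k + 3 * j - 1) = 1 \<and> b (2 * k + 3 * j) = x j - 1 \<and>
      b (2 * k + 3 * j + 1) = u (j + 1) * y j - 1" if j: "j \<ge> 1" for j
  proof -
    obtain i where i: "j = Suc i" using j by (cases j) auto
    have "2 * k + 3 * j - 1 = 2 * k + 3 * i + 2" "2 * k + 3 * j = 2 * k + 3 * i + 3"
      "2 * k + 3 * j + 1 = 2 * k + 3 * i + 4" by (simp_all add: i)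
    then show ?thesis using b2[of i] b3[of i] b4[of i] i by (simp only:) simp
  qed
  have sign: "b j > 0 \<or> (j = 2 * k + 1 \<and> b j = 0 \<and> m = 0 \<and> u 1 = 1 \<and> cfrac_denom a (2 * k - 1) = 2)"
    if "j \<ge> 1" for j
    using bpos[OF that] bnn[OF that] b1zero unfolding r_def by (cases "b j = 0") auto
  show ?thesis
    using summ b0 b1 late sign cval by (intro conjI exI[of _ b]) blast+
qed

end
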